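(* Let $A$ be a complex $m\times n$ matrix of rank at least $2$, and let $\overline{A}$ be the $m\times n$ matrix all of whose entries equal the arithmetic mean of the entries of $A$. Let $K:=2\sqrt{\|A\|_1\|A\|_\infty}/\sigma_2(A)$. Then $$\|A-\overline{A}\|_P\ge\frac{\sigma_2(A)}{32\sqrt2(\log K+4)}.$$
   Context: $\sigma_2(A)$ is the second largest singular value of $A$. $\|A\|_1$ is the largest absolute column sum and $\|A\|_\infty$ the largest absolute row sum of $A$. For a complex $m\times n$ matrix $B$, $\|B\|_P:=\max\frac{|\xi^tB\eta|}{\|\xi\|\|\eta\|}$ over all non-zero $\xi\in\{0,1\}^m$, $\eta\in\{0,1\}^n$, with $\|\cdot\|$ the Euclidean norm. $\log$ is the natural logarithm. *)

theory Defs
  imports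
    "HOL-Computational_Algebra.Polynomial"
    "Jordan_Normal_Form.Schur_Decomposition"
    "Jordan_Normal_Form.DL_Rank"
begin

text \<open>
  The singular values of an \<open>m \<times> n\<close> matrix are the \<open>min m n\<close> largest square roots of the
  eigenvalues of the adjoint of \<open>A\<close> times \<open>A\<close>, listed with multiplicity in decreasing order.
  These eigenvalues are real and nonnegative, so \<open>Re\<close> only changes their type. The dropped
  entries (when \<open>m < n\<close>) are zeros.
\<close>

definition singular_values :: "complex mat \<Rightarrow> real list" where
  "singular_values A =
     take (min (dim_row A) (dim_col A))
       (rev (sorted_list_of_multiset
         (image_mset (\<lambda>z. sqrt (Re z)) (proots (char_poly (mat_adjoint A * A))))))"

text \<open>List indices start at 0. The value is meaningful if both dimensions are at least 2.\<close>

definition sigma2 :: "complex mat \<Rightarrow> real" where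
  "sigma2 A = singular_values A ! 1"

text \<open>The maxima in the next two definitions assume positive dimensions.\<close>

definition norm_one :: "complex mat \<Rightarrow> real" where
  "norm_one A = (MAX j\<in>{..<dim_col A}. \<Sum>i<dim_row A. cmod (A $$ (i, j)))"

definition norm_infty :: "complex mat \<Rightarrow> real" where
  "norm_infty A = (MAX i\<in>{..<dim_row A}. \<Sum>j<dim_col A. cmod (A $$ (i, j)))"

definition euclid_norm :: "complex vec \<Rightarrow> real" where
  "euclid_norm v = sqrt (\<Sum>i<dim_vec v. (cmod (v $ i))\<^sup>2)"

definition zero_one_vecs :: "nat \<Rightarrow> complex vec set" where
  "zero_one_vecs k = {v \<in> carrier_vec k. v \<noteq> 0\<^sub>v k \<and> (\<forall>i<k. v $ i \<in> {0, 1})}"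

text \<open>
  The operator \<open>\<bullet>\<close> is bilinear (no conjugation), so the numerator is the modulus of
  \<open>\<xi>\<close>-transpose times \<open>B\<close> times \<open>\<eta>\<close>. The maximum ranges over a finite set, which is nonempty
  for positive dimensions.
\<close>

definition norm_P :: "complex mat \<Rightarrow> real" where
  "norm_P B =
     (MAX (\<xi>, \<eta>) \<in> zero_one_vecs (dim_row B) \<times> zero_one_vecs (dim_col B).
        cmod (\<xi> \<bullet> (B *\<^sub>v \<eta>)) / (euclid_norm \<xi> * euclid_norm \<eta>))"

definition mean_mat :: "complex mat \<Rightarrow> complex mat" where
  "mean_mat A =
     mat (dim_row A) (dim_col A)
       (\<lambda>_. (\<Sum>i<dim_row A. \<Sum>j<dim_col A. A $$ (i, j)) / of_nat (dim_row A * dim_col A))"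

end

theory Submission
  imports Defs
begin

text \<open>
  The two leading eigenvectors of the Gram matrix of \<open>A\<close> span a plane that contains a nonzero vector \<open>y\<close>
  with entries summing to zero. On it the mean matrix vanishes, so \<open>B = A - mean_mat A\<close> satisfies
  \<open>\<parallel>B y\<parallel> = \<parallel>A y\<parallel> \<ge> sigma2 A * \<parallel>y\<parallel>\<close>, and it remains to bound the spectral norm of \<open>B\<close> by \<open>norm_P B\<close>.
  Splitting into nonnegative vectors costs a factor 4. Nonnegative vectors are expanded in binary digits,
  that is, into indicator vectors of weight \<open>2\<^sup>k\<close> and \<open>2\<^sup>l\<close>: the pairs with \<open>k - l\<close> in a window of
  logarithmic length are controlled by \<open>norm_P B\<close>, the others by the row and column sums of \<open>B\<close>,
  which are at most twice those of \<open>A\<close>.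
\<close>

section \<open>Binary digits of natural numbers\<close>

definition binary_digit :: "nat \<Rightarrow> nat \<Rightarrow> nat" where
  "binary_digit k N = N div 2 ^ k mod 2"

lemma binary_digit_cases: "binary_digit k N = 0 \<or> binary_digit k N = 1"
  unfolding binary_digit_def by presburger

lemma sum_binary_digit: "(\<Sum>k<M. binary_digit k N * 2 ^ k) = N mod 2 ^ M"
proof (induction M)
  case (Suc M)
  have "N mod 2 ^ Suc M = 2 ^ M * (N div 2 ^ M mod 2) + N mod 2 ^ M"
    using mod_mult2_eq[of N "2 ^ M" 2] by (simp add: mult.commute)
  then show ?case using Suc by (simp add: binary_digit_def)
qed simp

lemma sum_binary_digit_of_nat:
  assumes "N < 2 ^ M"
  shows "of_nat N = (\<Sum>k<M. of_nat (binary_digit k N) * (2::'a::semiring_1) ^ k)"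
proof -
  have "N = (\<Sum>k<M. binary_digit k N * 2 ^ k)"
    using assms by (simp add: sum_binary_digit)
  then have "(of_nat N :: 'a) = of_nat (\<Sum>k<M. binary_digit k N * 2 ^ k)" by simp
  then show ?thesis by simp
qed

lemma sum_squares_le_square_sum:
  fixes f :: "'i \<Rightarrow> nat"
  assumes "finite I"
  shows "(\<Sum>i\<in>I. (f i)\<^sup>2) \<le> (\<Sum>i\<in>I. f i)\<^sup>2"
  using assms
proof (induction I)
  case (insert i I)
  then show ?case by (simp add: power2_sum)
qed simp

text \<open>A digit is its own square, so the left side is the sum of the squares of the terms of
  the binary expansion, and their cross products are nonnegative. Hence splitting a vector into
  digit levels does not increase the total of the squared norms.\<close>

lemma sum_binary_digit_square_le:
  assumes "N < 2 ^ M"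
  shows "(\<Sum>k<M. real (binary_digit k N) * 4 ^ k) \<le> (real N)\<^sup>2"
proof -
  have "(\<Sum>k<M. binary_digit k N * 4 ^ k) = (\<Sum>k<M. (binary_digit k N * 2 ^ k)\<^sup>2)"
  proof (rule sum.cong)
    fix k
    have "((2::nat) ^ k)\<^sup>2 = 4 ^ k"
      by (simp add: power2_eq_square flip: power_mult_distrib)
    then show "binary_digit k N * 4 ^ k = (binary_digit k N * 2 ^ k)\<^sup>2"
      using binary_digit_cases[of k N] by (auto simp: power_mult_distrib)
  qed simp
  also have "\<dots> \<le> (\<Sum>k<M. binary_digit k N * 2 ^ k)\<^sup>2"
    by (rule sum_squares_le_square_sum) simp
  also have "\<dots> = N\<^sup>2" using assms by (simp add: sum_binary_digit)
  finally have "real (\<Sum>k<M. binary_digit k N * 4 ^ k) \<le> real (N\<^sup>2)"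
    using of_nat_le_iff by blast
  then show ?thesis by simp
qed

section \<open>Sums over levels and the form on integer vectors\<close>

text \<open>The threshold is an integer because it will be a level minus an integer shift; when it
  is not positive, the sum is empty. The strict inequality gives the constant 1.\<close>

lemma sum_power_two_less_int: "(\<Sum>k | k < M \<and> int k < z. (2::real) ^ k) \<le> 2 powi z"
proof (cases "z \<le> 0")
  case True
  then have "{k. k < M \<and> int k < z} = {}" by auto
  then show ?thesis by (simp only: sum.empty) simp
next
  case False
  have "(\<Sum>k | k < M \<and> int k < z. (2::real) ^ k) \<le> (\<Sum>k<nat z. 2 ^ k)"
    by (rule sum_mono2) auto
  also have "\<dots> = 2 ^ nat z - 1" by (simp add: geometric_sum)
  also have "\<dots> \<le> 2 powi z" using False by (simp add: power_int_def)
  finally show ?thesis .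
qed

lemma card_int_window:
  fixes p q :: int
  shows "card {l::nat. l < M \<and> p \<le> int l \<and> int l \<le> q} \<le> nat (q - p + 1)"
proof -
  have "card {l::nat. l < M \<and> p \<le> int l \<and> int l \<le> q} = card (int ` {l. l < M \<and> p \<le> int l \<and> int l \<le> q})"
    by (simp add: card_image)
  also have "\<dots> \<le> card {p..q}" by (rule card_mono) auto
  finally show ?thesis by simp
qed

text \<open>For fixed \<open>l\<close> the geometric sum over \<open>k < l - c\<close> is at most
  \<open>2 powi (l - c)\<close>, which cancels the growth allowed for \<open>Q\<close> and leaves
  \<open>4 ^ l\<close>. It serves the pairs outside the window on both sides, the second time with
  the roles of the two levels exchanged.\<close>

lemma far_sum_le:
  fixes c :: int and \<delta> Q :: real
  assumes Q: "Q \<le> \<delta> * 2 powi c" and \<delta>: "\<delta> \<ge> 0" and s: "\<And>l. s l \<ge> 0"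
  shows "(\<Sum>l<M. \<Sum>k<M'. if int l - int k > c then Q * s l * 2 ^ (k + l) else 0)
    \<le> \<delta> * (\<Sum>l<M. s l * 4 ^ l)"
proof -
  have "(\<Sum>k<M'. if int l - int k > c then Q * s l * 2 ^ (k + l) else 0) \<le> \<delta> * (s l * 4 ^ l)" for l
  proof -
    have "(\<Sum>k<M'. if int l - int k > c then Q * s l * 2 ^ (k + l) else 0)
      = (\<Sum>k | k < M' \<and> int k < int l - c. Q * (s l * 2 ^ l) * 2 ^ k)"
      by (rule sum.mono_neutral_cong_right) (auto simp: power_add)
    also have "\<dots> = Q * (s l * 2 ^ l * (\<Sum>k | k < M' \<and> int k < int l - c. 2 ^ k))"
      by (simp add: sum_distrib_left mult_ac)
    also have "\<dots> \<le> \<delta> * 2 powi c * (s l * 2 ^ l * (\<Sum>k | k < M' \<and> int k < int l - c. 2 ^ k))"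
      by (intro mult_right_mono Q mult_nonneg_nonneg s sum_nonneg) auto
    also have "\<dots> \<le> \<delta> * 2 powi c * (s l * 2 ^ l * 2 powi (int l - c))"
      by (intro mult_left_mono sum_power_two_less_int mult_nonneg_nonneg s \<delta>) auto
    also have "\<dots> = \<delta> * (s l * (2 ^ l * 2 ^ l))"
      by (simp add: power_int_diff)
    also have "(2::real) ^ l * 2 ^ l = 4 ^ l" by (simp flip: power_mult_distrib)
    finally show ?thesis .
  qed
  then show ?thesis by (simp add: sum_distrib_left sum_mono)
qed

text \<open>A binary expansion writes a vector with entries in \<open>\<nat>\<close> as a combination of indicator vectors.
  The pairs of levels with \<open>- d \<le> l - k \<le> c\<close> are estimated by the cut bound \<open>P\<close>; for the others the
  row and column sums suffice, and the geometric decay in \<open>\<bar>k - l\<bar>\<close> makes them small.\<close>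

lemma bilinear_form_bound_nat:
  fixes f :: "nat \<Rightarrow> nat \<Rightarrow> complex" and u v :: "nat \<Rightarrow> nat" and c d :: int
  assumes P: "\<And>S T. S \<subseteq> {..<m} \<Longrightarrow> T \<subseteq> {..<n} \<Longrightarrow>
      cmod (\<Sum>i\<in>S. \<Sum>j\<in>T. f i j) \<le> P * (sqrt (card S) * sqrt (card T))"
    and "P \<ge> 0" and "\<delta> \<ge> 0"
    and row: "\<And>i. i < m \<Longrightarrow> (\<Sum>j<n. cmod (f i j)) \<le> R"
    and col: "\<And>j. j < n \<Longrightarrow> (\<Sum>i<m. cmod (f i j)) \<le> C"
    and C: "C \<le> \<delta> * 2 powi c" and R: "R \<le> \<delta> * 2 powi d"
  shows "cmod (\<Sum>i<m. \<Sum>j<n. of_nat (u i) * f i j * of_nat (v j))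
    \<le> (P * nat (c + d + 1) / 2 + \<delta>) * ((\<Sum>i<m. (real (u i))\<^sup>2) + (\<Sum>j<n. (real (v j))\<^sup>2))"
proof -
  \<comment> \<open>A crude number of digits: every entry is at most \<open>M\<close>, and
    \<open>M < 2 ^ M\<close>.\<close>
  define M where "M = (\<Sum>i<m. u i) + (\<Sum>j<n. v j)"
  have small: "N < 2 ^ M" if "N \<le> M" for N
    using that less_exp[of M] by (meson le_less_trans)
  have u: "u i < 2 ^ M" if "i < m" for i
    by (rule small) (use that member_le_sum[of i "{..<m}" u] in \<open>simp add: M_def\<close>)
  have v: "v j < 2 ^ M" if "j < n" for j
    by (rule small) (use that member_le_sum[of j "{..<n}" v] in \<open>simp add: M_def\<close>)
  define S where "S k = {i\<in>{..<m}. binary_digit k (u i) = 1}" for k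
  define T where "T l = {j\<in>{..<n}. binary_digit l (v j) = 1}" for l
  have ind_S: "(\<Sum>i<m. of_nat (binary_digit k (u i)) * g i) = (\<Sum>i\<in>S k. g i)" for k and g :: "nat \<Rightarrow> complex"
    unfolding S_def using binary_digit_cases by (intro sum.mono_neutral_cong_right) force+
  have ind_T: "(\<Sum>j<n. of_nat (binary_digit l (v j)) * g j) = (\<Sum>j\<in>T l. g j)" for l and g :: "nat \<Rightarrow> complex"
    unfolding T_def using binary_digit_cases by (intro sum.mono_neutral_cong_right) force+
  have card_S: "real (card (S k)) = (\<Sum>i<m. real (binary_digit k (u i)))" for k
  proof -
    have "(\<Sum>i<m. real (binary_digit k (u i))) = (\<Sum>i\<in>S k. 1)"
      unfolding S_def using binary_digit_cases by (intro sum.mono_neutral_cong_right) force+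
    then show ?thesis by simp
  qed
  have card_T: "real (card (T l)) = (\<Sum>j<n. real (binary_digit l (v j)))" for l
  proof -
    have "(\<Sum>j<n. real (binary_digit l (v j))) = (\<Sum>j\<in>T l. 1)"
      unfolding T_def using binary_digit_cases by (intro sum.mono_neutral_cong_right) force+
    then show ?thesis by simp
  qed
  define h where "h k l = (\<Sum>i\<in>S k. \<Sum>j\<in>T l. f i j)" for k l
  have "(\<Sum>i<m. \<Sum>j<n. of_nat (u i) * f i j * of_nat (v j))
    = (\<Sum>i<m. \<Sum>j<n. (\<Sum>k<M. of_nat (binary_digit k (u i)) * 2 ^ k) * f i j * (\<Sum>l<M. of_nat (binary_digit l (v j)) * 2 ^ l))"
    by (intro sum.cong refl) (simp add: u v flip: sum_binary_digit_of_nat)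
  also have "\<dots> = (\<Sum>i<m. \<Sum>j<n. \<Sum>k<M. \<Sum>l<M. 2 ^ (k + l) * (of_nat (binary_digit k (u i)) * (of_nat (binary_digit l (v j)) * f i j)))"
    by (simp add: sum_distrib_left sum_distrib_right power_add mult_ac)
  also have "\<dots> = (\<Sum>k<M. \<Sum>i<m. \<Sum>j<n. \<Sum>l<M. 2 ^ (k + l) * (of_nat (binary_digit k (u i)) * (of_nat (binary_digit l (v j)) * f i j)))"
    \<comment> \<open>These instances only move a sum over levels outwards past a sum over indices,
      so the rewriting terminates.\<close>
    by (simp only: sum.swap[of _ "{..<M}" "{..<n}"] sum.swap[of _ "{..<M}" "{..<m}"])
  also have "\<dots> = (\<Sum>k<M. \<Sum>l<M. \<Sum>i<m. \<Sum>j<n. 2 ^ (k + l) * (of_nat (binary_digit k (u i)) * (of_nat (binary_digit l (v j)) * f i j)))"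
    by (simp only: sum.swap[of _ "{..<M}" "{..<n}"] sum.swap[of _ "{..<M}" "{..<m}"])
  also have "\<dots> = (\<Sum>k<M. \<Sum>l<M. 2 ^ (k + l) * h k l)"
    unfolding h_def by (simp add: ind_S ind_T flip: sum_distrib_left)
  finally have expand: "(\<Sum>i<m. \<Sum>j<n. of_nat (u i) * f i j * of_nat (v j)) = (\<Sum>k<M. \<Sum>l<M. 2 ^ (k + l) * h k l)" .
  \<comment> \<open>\<open>a k\<close> and \<open>b l\<close> are the squared norms of the level
    pieces, that is, of \<open>2 ^ k\<close> and \<open>2 ^ l\<close> times the indicators of
    \<open>S k\<close> and \<open>T l\<close>.\<close>
  define a where "a k = real (card (S k)) * 4 ^ k" for k
  define b where "b l = real (card (T l)) * 4 ^ l" for l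
  \<comment> \<open>The arithmetic-geometric mean inequality separates the two levels, so that each
    summand depends on only one of them and can be counted over the window; it is the source of the
    factor 1/2.\<close>
  have near: "cmod (2 ^ (k + l) * h k l) \<le> P / 2 * (a k + b l)" for k l
  proof -
    have "cmod (2 ^ (k + l) * h k l) = 2 ^ (k + l) * cmod (h k l)" by (simp add: norm_mult norm_power)
    also have "\<dots> \<le> 2 ^ (k + l) * (P * (sqrt (card (S k)) * sqrt (card (T l))))"
      unfolding h_def by (intro mult_left_mono P) (auto simp: S_def T_def)
    also have "\<dots> = P * ((2 ^ k * sqrt (card (S k))) * (2 ^ l * sqrt (card (T l))))"
      by (simp add: power_add)
    also have "\<dots> \<le> P * (((2 ^ k * sqrt (card (S k)))\<^sup>2 + (2 ^ l * sqrt (card (T l)))\<^sup>2) / 2)"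
      using sum_squares_bound[of "2 ^ k * sqrt (card (S k))" "2 ^ l * sqrt (card (T l))"]
      by (intro mult_left_mono) (auto simp: \<open>P \<ge> 0\<close>)
    also have "\<dots> = P / 2 * (a k + b l)"
      using power_mult_distrib[of "2::real" 2]
      by (simp add: a_def b_def power_mult_distrib mult.commute power2_eq_square[of "2 ^ _"])
    finally show ?thesis .
  qed
  \<comment> \<open>Summing by columns charges \<open>C\<close> to each element of
    \<open>T l\<close>, whatever \<open>S k\<close> is; \<open>row_far\<close> does the same by
    rows.\<close>
  have col_far: "cmod (2 ^ (k + l) * h k l) \<le> C * card (T l) * 2 ^ (k + l)" for k l
  proof -
    have "cmod (h k l) \<le> (\<Sum>j\<in>T l. \<Sum>i\<in>S k. cmod (f i j))"
      unfolding h_def by (subst sum.swap) (intro sum_norm_le order_refl)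
    also have "\<dots> \<le> (\<Sum>j\<in>T l. C)"
    proof (rule sum_mono)
      fix j assume j: "j \<in> T l"
      have "(\<Sum>i\<in>S k. cmod (f i j)) \<le> (\<Sum>i<m. cmod (f i j))"
        by (rule sum_mono2) (auto simp: S_def)
      also have "\<dots> \<le> C" using j by (intro col) (auto simp: T_def)
      finally show "(\<Sum>i\<in>S k. cmod (f i j)) \<le> C" .
    qed
    finally have "2 ^ (k + l) * cmod (h k l) \<le> 2 ^ (k + l) * (C * card (T l))"
      by (intro mult_left_mono) (simp_all add: mult.commute)
    then show ?thesis by (simp add: norm_mult norm_power mult_ac)
  qed
  have row_far: "cmod (2 ^ (k + l) * h k l) \<le> R * card (S k) * 2 ^ (l + k)" for k l
  proof -
    have "cmod (h k l) \<le> (\<Sum>i\<in>S k. \<Sum>j\<in>T l. cmod (f i j))"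
      unfolding h_def by (intro sum_norm_le order_refl)
    also have "\<dots> \<le> (\<Sum>i\<in>S k. R)"
    proof (rule sum_mono)
      fix i assume i: "i \<in> S k"
      have "(\<Sum>j\<in>T l. cmod (f i j)) \<le> (\<Sum>j<n. cmod (f i j))"
        by (rule sum_mono2) (auto simp: T_def)
      also have "\<dots> \<le> R" using i by (intro row) (auto simp: S_def)
      finally show "(\<Sum>j\<in>T l. cmod (f i j)) \<le> R" .
    qed
    finally have "2 ^ (k + l) * cmod (h k l) \<le> 2 ^ (k + l) * (R * card (S k))"
      by (intro mult_left_mono) (simp_all add: mult.commute)
    then show ?thesis by (simp add: norm_mult norm_power power_add mult_ac)
  qed
  define w where "w k l \<longleftrightarrow> - d \<le> int l - int k \<and> int l - int k \<le> c" for k l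
  define n1 where "n1 k l = (if w k l then P / 2 * a k else 0)" for k l
  define n2 where "n2 k l = (if w k l then P / 2 * b l else 0)" for k l
  define f1 where "f1 k l = (if int l - int k > c then C * card (T l) * 2 ^ (k + l) else 0)" for k l
  define f2 where "f2 k l = (if int k - int l > d then R * card (S k) * 2 ^ (l + k) else 0)" for k l
  have nonneg: "f1 k l \<ge> 0" "f2 k l \<ge> 0" for k l
    using order.trans[OF norm_ge_zero col_far[of k l]] order.trans[OF norm_ge_zero row_far[of k l]]
    by (auto simp: f1_def f2_def)
  have "cmod (2 ^ (k + l) * h k l) \<le> n1 k l + n2 k l + f1 k l + f2 k l" for k l
  proof -
    \<comment> \<open>If the window is empty, the last two cases can overlap; the extra terms are
      nonnegative and do no harm.\<close>
    consider "w k l" | "int l - int k > c" | "int k - int l > d" unfolding w_def by linarith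
    then show ?thesis
    proof cases
      case 1
      then show ?thesis using near[of k l] nonneg[of k l] by (simp add: n1_def n2_def distrib_left)
    next
      case 2
      then have "\<not> w k l" by (simp add: w_def)
      then show ?thesis using 2 col_far[of k l] nonneg[of k l] by (simp add: n1_def n2_def f1_def)
    next
      case 3
      then have "\<not> w k l" by (simp add: w_def)
      then show ?thesis using 3 row_far[of k l] nonneg[of k l] by (simp add: n1_def n2_def f2_def)
    qed
  qed
  then have "cmod (\<Sum>k<M. \<Sum>l<M. 2 ^ (k + l) * h k l) \<le> (\<Sum>k<M. \<Sum>l<M. n1 k l + n2 k l + f1 k l + f2 k l)"
    by (intro sum_norm_le)
  also have "\<dots> = (\<Sum>k<M. \<Sum>l<M. n1 k l) + (\<Sum>l<M. \<Sum>k<M. n2 k l) + (\<Sum>l<M. \<Sum>k<M. f1 k l) + (\<Sum>k<M. \<Sum>l<M. f2 k l)"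
    by (simp add: sum.distrib sum.swap[of n2] sum.swap[of f1])
  also have "\<dots> \<le> P / 2 * nat (c + d + 1) * (\<Sum>k<M. a k) + P / 2 * nat (c + d + 1) * (\<Sum>l<M. b l)
      + \<delta> * (\<Sum>l<M. b l) + \<delta> * (\<Sum>k<M. a k)"
  proof (intro add_mono)
    \<comment> \<open>For fixed \<open>k\<close> the window leaves at most \<open>c + d + 1\<close>
      values of \<open>l\<close>, and for fixed \<open>l\<close> as many values of
      \<open>k\<close>.\<close>
    have "(\<Sum>l<M. n1 k l) \<le> P / 2 * nat (c + d + 1) * a k" for k
    proof -
      have "(\<Sum>l<M. n1 k l) = (\<Sum>l | l < M \<and> int k - d \<le> int l \<and> int l \<le> int k + c. P / 2 * a k)"
        by (rule sum.mono_neutral_cong_right) (auto simp: n1_def w_def)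
      also have "\<dots> = card {l. l < M \<and> int k - d \<le> int l \<and> int l \<le> int k + c} * (P / 2 * a k)" by simp
      also have "\<dots> \<le> nat (c + d + 1) * (P / 2 * a k)"
        using card_int_window[of M "int k - d" "int k + c"] \<open>P \<ge> 0\<close>
        by (intro mult_right_mono) (simp_all add: a_def add_ac)
      finally show ?thesis by (simp add: mult_ac)
    qed
    then show "(\<Sum>k<M. \<Sum>l<M. n1 k l) \<le> P / 2 * nat (c + d + 1) * (\<Sum>k<M. a k)"
      by (simp only: sum_distrib_left) (rule sum_mono)
    have "(\<Sum>k<M. n2 k l) \<le> P / 2 * nat (c + d + 1) * b l" for l
    proof -
      have "(\<Sum>k<M. n2 k l) = (\<Sum>k | k < M \<and> int l - c \<le> int k \<and> int k \<le> int l + d. P / 2 * b l)"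
        by (rule sum.mono_neutral_cong_right) (auto simp: n2_def w_def)
      also have "\<dots> = card {k. k < M \<and> int l - c \<le> int k \<and> int k \<le> int l + d} * (P / 2 * b l)" by simp
      also have "\<dots> \<le> nat (c + d + 1) * (P / 2 * b l)"
        using card_int_window[of M "int l - c" "int l + d"] \<open>P \<ge> 0\<close>
        by (intro mult_right_mono) (simp_all add: b_def add_ac)
      finally show ?thesis by (simp add: mult_ac)
    qed
    then show "(\<Sum>l<M. \<Sum>k<M. n2 k l) \<le> P / 2 * nat (c + d + 1) * (\<Sum>l<M. b l)"
      by (simp only: sum_distrib_left) (rule sum_mono)
    show "(\<Sum>l<M. \<Sum>k<M. f1 k l) \<le> \<delta> * (\<Sum>l<M. b l)"
      unfolding f1_def b_def by (rule far_sum_le) (use C \<open>\<delta> \<ge> 0\<close> in auto)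
    show "(\<Sum>k<M. \<Sum>l<M. f2 k l) \<le> \<delta> * (\<Sum>k<M. a k)"
      unfolding f2_def a_def by (rule far_sum_le) (use R \<open>\<delta> \<ge> 0\<close> in auto)
  qed
  also have "\<dots> = (P * nat (c + d + 1) / 2 + \<delta>) * ((\<Sum>k<M. a k) + (\<Sum>l<M. b l))"
    by (simp add: algebra_simps)
  also have "\<dots> \<le> (P * nat (c + d + 1) / 2 + \<delta>) * ((\<Sum>i<m. (real (u i))\<^sup>2) + (\<Sum>j<n. (real (v j))\<^sup>2))"
  proof (intro mult_left_mono add_mono)
    have "(\<Sum>k<M. a k) = (\<Sum>i<m. \<Sum>k<M. real (binary_digit k (u i)) * 4 ^ k)"
      unfolding a_def card_S sum_distrib_right by (rule sum.swap)
    also have "\<dots> \<le> (\<Sum>i<m. (real (u i))\<^sup>2)"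
      by (intro sum_mono sum_binary_digit_square_le u) auto
    finally show "(\<Sum>k<M. a k) \<le> (\<Sum>i<m. (real (u i))\<^sup>2)" .
    have "(\<Sum>l<M. b l) = (\<Sum>j<n. \<Sum>l<M. real (binary_digit l (v j)) * 4 ^ l)"
      unfolding b_def card_T sum_distrib_right by (rule sum.swap)
    also have "\<dots> \<le> (\<Sum>j<n. (real (v j))\<^sup>2)"
      by (intro sum_mono sum_binary_digit_square_le v) auto
    finally show "(\<Sum>l<M. b l) \<le> (\<Sum>j<n. (real (v j))\<^sup>2)" .
  qed (use \<open>P \<ge> 0\<close> \<open>\<delta> \<ge> 0\<close> in auto)
  finally show ?thesis unfolding expand .
qed

section \<open>From integer to nonnegative and complex vectors\<close>

lemma tendsto_nat_floor_divide:
  fixes a :: real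
  assumes "a \<ge> 0"
  shows "(\<lambda>k. real (nat \<lfloor>real k * a\<rfloor>) / real k) \<longlonglongrightarrow> a"
proof (rule tendsto_sandwich)
  have eq: "real (nat \<lfloor>real k * a\<rfloor>) = of_int \<lfloor>real k * a\<rfloor>" for k
    using assms by simp
  show "\<forall>\<^sub>F k in sequentially. a - inverse (real k) \<le> real (nat \<lfloor>real k * a\<rfloor>) / real k"
    using eventually_gt_at_top[of 0]
  proof eventually_elim
    case (elim k)
    have "a = (real k * a) / real k" using elim by simp
    also have "\<dots> \<le> (of_int \<lfloor>real k * a\<rfloor> + 1) / real k"
      by (intro divide_right_mono) (use floor_correct[of "real k * a"] in linarith)+
    finally show ?case unfolding eq by (simp add: add_divide_distrib inverse_eq_divide)
  qed
  show "\<forall>\<^sub>F k in sequentially. real (nat \<lfloor>real k * a\<rfloor>) / real k \<le> a"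
    using eventually_gt_at_top[of 0]
  proof eventually_elim
    case (elim k)
    then show ?case unfolding eq by (simp add: field_simps)
  qed
  show "(\<lambda>k. a - inverse (real k)) \<longlonglongrightarrow> a"
    using tendsto_diff[OF tendsto_const lim_inverse_n, of a] by simp
qed simp

text \<open>Both sides are continuous and homogeneous of degree 2: apply the integer bound to the
  floors of \<open>k * u i\<close> and \<open>k * v j\<close>, divide by the square of
  \<open>k\<close>, and let \<open>k\<close> tend to infinity.\<close>

lemma bilinear_form_bound_nonneg:
  fixes f :: "nat \<Rightarrow> nat \<Rightarrow> complex" and u v :: "nat \<Rightarrow> real"
  assumes bound: "\<And>u v. cmod (\<Sum>i<m. \<Sum>j<n. of_nat (u i) * f i j * of_nat (v j))
      \<le> \<kappa> * ((\<Sum>i<m. (real (u i))\<^sup>2) + (\<Sum>j<n. (real (v j))\<^sup>2))"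
    and u: "\<And>i. u i \<ge> 0" and v: "\<And>j. v j \<ge> 0"
  shows "cmod (\<Sum>i<m. \<Sum>j<n. of_real (u i) * f i j * of_real (v j))
    \<le> \<kappa> * ((\<Sum>i<m. (u i)\<^sup>2) + (\<Sum>j<n. (v j)\<^sup>2))"
proof (rule LIMSEQ_le)
  define r where "r k a = real (nat \<lfloor>real k * a\<rfloor>) / real k" for k a
  show "(\<lambda>k. cmod (\<Sum>i<m. \<Sum>j<n. of_real (r k (u i)) * f i j * of_real (r k (v j))))
      \<longlonglongrightarrow> cmod (\<Sum>i<m. \<Sum>j<n. of_real (u i) * f i j * of_real (v j))"
    unfolding r_def by (intro tendsto_intros tendsto_nat_floor_divide u v)
  show "(\<lambda>k. \<kappa> * ((\<Sum>i<m. (r k (u i))\<^sup>2) + (\<Sum>j<n. (r k (v j))\<^sup>2)))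
      \<longlonglongrightarrow> \<kappa> * ((\<Sum>i<m. (u i)\<^sup>2) + (\<Sum>j<n. (v j)\<^sup>2))"
    unfolding r_def by (intro tendsto_intros tendsto_nat_floor_divide u v)
  have "cmod (\<Sum>i<m. \<Sum>j<n. of_real (r k (u i)) * f i j * of_real (r k (v j)))
      \<le> \<kappa> * ((\<Sum>i<m. (r k (u i))\<^sup>2) + (\<Sum>j<n. (r k (v j))\<^sup>2))" for k
  proof -
    define U V where "U i = nat \<lfloor>real k * u i\<rfloor>" and "V j = nat \<lfloor>real k * v j\<rfloor>" for i j
    \<comment> \<open>Also valid for \<open>k = 0\<close>, where every quotient is 0.\<close>
    have "(\<Sum>i<m. \<Sum>j<n. of_real (r k (u i)) * f i j * of_real (r k (v j)))
        = (\<Sum>i<m. \<Sum>j<n. of_nat (U i) * f i j * of_nat (V j)) / (of_nat k)\<^sup>2"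
      by (simp add: sum_divide_distrib r_def U_def V_def power2_eq_square mult_ac)
    then have "cmod (\<Sum>i<m. \<Sum>j<n. of_real (r k (u i)) * f i j * of_real (r k (v j)))
        = cmod (\<Sum>i<m. \<Sum>j<n. of_nat (U i) * f i j * of_nat (V j)) / (real k)\<^sup>2"
      by (simp add: norm_divide norm_power)
    also have "\<dots> \<le> \<kappa> * ((\<Sum>i<m. (real (U i))\<^sup>2) + (\<Sum>j<n. (real (V j))\<^sup>2)) / (real k)\<^sup>2"
      by (intro divide_right_mono bound) simp
    also have "\<dots> = \<kappa> * ((\<Sum>i<m. (r k (u i))\<^sup>2) + (\<Sum>j<n. (r k (v j))\<^sup>2))"
      by (simp add: r_def U_def V_def power_divide add_divide_distrib[symmetric] flip: sum_divide_distrib)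
    finally show ?thesis .
  qed
  then show "\<exists>N. \<forall>k\<ge>N. cmod (\<Sum>i<m. \<Sum>j<n. of_real (r k (u i)) * f i j * of_real (r k (v j)))
      \<le> \<kappa> * ((\<Sum>i<m. (r k (u i))\<^sup>2) + (\<Sum>j<n. (r k (v j))\<^sup>2))"
    by blast
qed

text \<open>The nonnegative coefficients of \<open>1, \<i>, - 1, - \<i>\<close> in a complex number, for \<open>p < 4\<close>.\<close>

definition quarter_part :: "nat \<Rightarrow> complex \<Rightarrow> real" where
  "quarter_part p z = max 0 (Re (z * (- \<i>) ^ p))"

lemma quarter_part_nonneg: "quarter_part p z \<ge> 0"
  by (simp add: quarter_part_def)

lemma quarter_part_simps:
  "quarter_part 0 z = max 0 (Re z)" "quarter_part 1 z = max 0 (Im z)"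
  "quarter_part 2 z = max 0 (- Re z)" "quarter_part 3 z = max 0 (- Im z)"
  by (simp_all add: quarter_part_def power3_eq_cube)

lemma sum_lessThan_4: "(\<Sum>p<4::nat. g p) = g 0 + g 1 + g 2 + (g 3 :: 'a::comm_monoid_add)"
  by (simp add: eval_nat_numeral)

lemma sum_quarter_part: "(\<Sum>p<4. \<i> ^ p * of_real (quarter_part p z)) = z"
proof -
  have "max 0 a - max 0 (- a) = a" for a :: real by (simp add: max_def)
  then show ?thesis
    by (simp add: sum_lessThan_4 quarter_part_simps complex_eq_iff power3_eq_cube del: One_nat_def)
qed

text \<open>Of two opposite parts at most one is nonzero, so the squares add up without cross
  terms.\<close>

lemma sum_quarter_part_square: "(\<Sum>p<4. (quarter_part p z)\<^sup>2) = (cmod z)\<^sup>2"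
proof -
  have "(max 0 a)\<^sup>2 + (max 0 (- a))\<^sup>2 = a\<^sup>2" for a :: real by (simp add: max_def)
  from this[of "Re z"] this[of "Im z"] show ?thesis
    by (simp add: sum_lessThan_4 quarter_part_simps cmod_power2 del: One_nat_def)
qed

text \<open>Sixteen pairs of parts occur, and each part lies in four of them. As the squared norms
  of the parts add up to that of the vector, the total loss is the factor 4.\<close>

lemma bilinear_form_bound_complex:
  fixes f :: "nat \<Rightarrow> nat \<Rightarrow> complex" and x y :: "nat \<Rightarrow> complex"
  assumes bound: "\<And>u v. (\<And>i. u i \<ge> 0) \<Longrightarrow> (\<And>j. v j \<ge> 0) \<Longrightarrow>
      cmod (\<Sum>i<m. \<Sum>j<n. of_real (u i) * f i j * of_real (v j))
      \<le> \<kappa> * ((\<Sum>i<m. (u i)\<^sup>2) + (\<Sum>j<n. (v j)\<^sup>2))"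
  shows "cmod (\<Sum>i<m. \<Sum>j<n. x i * f i j * y j)
    \<le> 4 * \<kappa> * ((\<Sum>i<m. (cmod (x i))\<^sup>2) + (\<Sum>j<n. (cmod (y j))\<^sup>2))"
proof -
  let ?u = "\<lambda>p i. quarter_part p (x i)" and ?v = "\<lambda>q j. quarter_part q (y j)"
  let ?g = "\<lambda>i j p q. \<i> ^ (p + q) * (of_real (?u p i) * f i j * of_real (?v q j))"
  have "(\<Sum>i<m. \<Sum>j<n. x i * f i j * y j)
    = (\<Sum>i<m. \<Sum>j<n. (\<Sum>p<4. \<i> ^ p * of_real (?u p i)) * f i j * (\<Sum>q<4. \<i> ^ q * of_real (?v q j)))"
    by (simp only: sum_quarter_part)
  also have "\<dots> = (\<Sum>i<m. \<Sum>j<n. \<Sum>p<4. \<Sum>q<4. ?g i j p q)"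
    by (simp only: sum_distrib_left sum_distrib_right power_add mult_ac)
  also have "\<dots> = (\<Sum>p<4. \<Sum>i<m. \<Sum>j<n. \<Sum>q<4. ?g i j p q)"
    by (simp only: sum.swap[of _ "{..<4}" "{..<n}"] sum.swap[of _ "{..<4}" "{..<m}"])
  also have "\<dots> = (\<Sum>p<4. \<Sum>q<4. \<Sum>i<m. \<Sum>j<n. ?g i j p q)"
    by (simp only: sum.swap[of _ "{..<4}" "{..<n}"] sum.swap[of _ "{..<4}" "{..<m}"])
  also have "\<dots> = (\<Sum>p<4. \<Sum>q<4. \<i> ^ (p + q) * (\<Sum>i<m. \<Sum>j<n. of_real (?u p i) * f i j * of_real (?v q j)))"
    by (simp only: sum_distrib_left)
  finally have "cmod (\<Sum>i<m. \<Sum>j<n. x i * f i j * y j)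
    = cmod (\<Sum>p<4. \<Sum>q<4. \<i> ^ (p + q) * (\<Sum>i<m. \<Sum>j<n. of_real (?u p i) * f i j * of_real (?v q j)))"
    by (rule arg_cong)
  also have "\<dots> \<le> (\<Sum>p<4. \<Sum>q<4. \<kappa> * ((\<Sum>i<m. (?u p i)\<^sup>2) + (\<Sum>j<n. (?v q j)\<^sup>2)))"
  proof (intro sum_norm_le)
    fix p q
    show "cmod (\<i> ^ (p + q) * (\<Sum>i<m. \<Sum>j<n. of_real (?u p i) * f i j * of_real (?v q j)))
      \<le> \<kappa> * ((\<Sum>i<m. (?u p i)\<^sup>2) + (\<Sum>j<n. (?v q j)\<^sup>2))"
      using bound[of "?u p" "?v q"] by (simp add: norm_mult norm_power quarter_part_nonneg)
  qed
  also have "\<dots> = 4 * \<kappa> * ((\<Sum>p<4. \<Sum>i<m. (?u p i)\<^sup>2) + (\<Sum>q<4. \<Sum>j<n. (?v q j)\<^sup>2))"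
    by (simp add: sum.distrib distrib_left flip: sum_distrib_left)
  also have "\<dots> = 4 * \<kappa> * ((\<Sum>i<m. (cmod (x i))\<^sup>2) + (\<Sum>j<n. (cmod (y j))\<^sup>2))"
    by (simp only: sum.swap[of _ _ "{..<4}"] sum_quarter_part_square)
  finally show ?thesis .
qed

section \<open>Hermitian products and the Gram matrix\<close>

definition norm_square :: "complex vec \<Rightarrow> real" where
  "norm_square v = (\<Sum>i<dim_vec v. (cmod (v $ i))\<^sup>2)"

lemma scalar_prod_conjugate_self: "v \<bullet>c v = of_real (norm_square v)"
  by (simp add: scalar_prod_def norm_square_def lessThan_atLeast0 flip: complex_norm_square)

lemma norm_square_nonneg: "norm_square v \<ge> 0"
  by (simp add: norm_square_def sum_nonneg)

lemma norm_square_pos: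
  assumes "v \<in> carrier_vec n" "v \<noteq> 0\<^sub>v n"
  shows "norm_square v > 0"
proof -
  have "v \<bullet>c v \<noteq> 0" using assms by simp
  then have "norm_square v \<noteq> 0" by (auto simp: scalar_prod_conjugate_self)
  with norm_square_nonneg[of v] show ?thesis by linarith
qed

lemma scalar_prod_conjugate_commute:
  fixes v w :: "complex vec"
  assumes "v \<in> carrier_vec n" "w \<in> carrier_vec n"
  shows "v \<bullet>c w = cnj (w \<bullet>c v)"
  using assms by (simp add: scalar_prod_def mult.commute)

text \<open>Pythagoras: the mixed products vanish, one by \<open>orth\<close> and the other by
  conjugate symmetry.\<close>

lemma norm_square_orthogonal_combination:
  assumes v: "v \<in> carrier_vec n" and w: "w \<in> carrier_vec n" and orth: "v \<bullet>c w = 0"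
  shows "norm_square (\<alpha> \<cdot>\<^sub>v v + \<beta> \<cdot>\<^sub>v w) = (cmod \<alpha>)\<^sup>2 * norm_square v + (cmod \<beta>)\<^sup>2 * norm_square w"
proof -
  have orth': "w \<bullet>c v = 0" using scalar_prod_conjugate_commute[OF w v] orth by simp
  have cc: "conjugate v \<in> carrier_vec n" "conjugate w \<in> carrier_vec n" using v w by auto
  have "(\<alpha> \<cdot>\<^sub>v v + \<beta> \<cdot>\<^sub>v w) \<bullet>c (\<alpha> \<cdot>\<^sub>v v + \<beta> \<cdot>\<^sub>v w) = \<alpha> * cnj \<alpha> * (v \<bullet>c v) + \<beta> * cnj \<beta> * (w \<bullet>c w)"
    using v w cc orth orth'
    by (simp add: conjugate_add_vec[of _ n] conjugate_smult_vec add_scalar_prod_distrib[of _ n]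
        scalar_prod_add_distrib[of _ n])
  then have "complex_of_real (norm_square (\<alpha> \<cdot>\<^sub>v v + \<beta> \<cdot>\<^sub>v w))
    = of_real ((cmod \<alpha>)\<^sup>2 * norm_square v + (cmod \<beta>)\<^sup>2 * norm_square w)"
    by (simp add: scalar_prod_conjugate_self flip: complex_norm_square)
  then show ?thesis using of_real_eq_iff by blast
qed

lemma mat_adjoint_carrier:
  assumes "A \<in> carrier_mat m n"
  shows "mat_adjoint A \<in> carrier_mat n m"
  using assms by (auto simp: mat_adjoint_def)

lemma mat_adjoint_scalar_prod:
  fixes A :: "complex mat"
  assumes A: "A \<in> carrier_mat m n" and z: "z \<in> carrier_vec m" and w: "w \<in> carrier_vec n"
  shows "(mat_adjoint A *\<^sub>v z) \<bullet>c w = z \<bullet>c (A *\<^sub>v w)"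
proof -
  have "(mat_adjoint A *\<^sub>v z) \<bullet>c w = (\<Sum>i<n. (\<Sum>j<m. cnj (A $$ (j, i)) * z $ j) * cnj (w $ i))"
    using A z w
    by (simp add: scalar_prod_def mat_adjoint_def lessThan_atLeast0 mat_of_rows_def)
  also have "\<dots> = (\<Sum>j<m. z $ j * cnj (\<Sum>i<n. A $$ (j, i) * w $ i))"
    by (simp add: sum_distrib_left sum_distrib_right mult_ac) (rule sum.swap)
  also have "\<dots> = z \<bullet>c (A *\<^sub>v w)"
    using A z w by (simp add: scalar_prod_def lessThan_atLeast0)
  finally show ?thesis .
qed

text \<open>The adjoint moves to the other side of the product. This provides both the symmetry and
  the positivity of the Gram matrix.\<close>

lemma gram_scalar_prod:
  fixes A :: "complex mat"
  assumes A: "A \<in> carrier_mat m n" and v: "v \<in> carrier_vec n" and w: "w \<in> carrier_vec n"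
  shows "(mat_adjoint A * A *\<^sub>v v) \<bullet>c w = (A *\<^sub>v v) \<bullet>c (A *\<^sub>v w)"
proof -
  have "mat_adjoint A * A *\<^sub>v v = mat_adjoint A *\<^sub>v (A *\<^sub>v v)"
    using mat_adjoint_carrier[OF A] A v by (simp add: assoc_mult_mat_vec)
  then show ?thesis
    using mat_adjoint_scalar_prod[OF A _ w, of "A *\<^sub>v v"] A v by simp
qed

text \<open>Pair the eigenvector equation with \<open>v\<close> and take real parts. In particular
  \<open>Re e\<close> is nonnegative when \<open>v\<close> is not zero.\<close>

lemma norm_square_eigenvector:
  assumes A: "A \<in> carrier_mat m n" and v: "v \<in> carrier_vec n"
    and ev: "mat_adjoint A * A *\<^sub>v v = e \<cdot>\<^sub>v v"
  shows "norm_square (A *\<^sub>v v) = Re e * norm_square v"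
proof -
  have "complex_of_real (norm_square (A *\<^sub>v v)) = e * of_real (norm_square v)"
    using gram_scalar_prod[OF A v v] v by (simp add: ev flip: scalar_prod_conjugate_self)
  then have "Re (complex_of_real (norm_square (A *\<^sub>v v))) = Re (e * of_real (norm_square v))" by simp
  then show ?thesis by simp
qed

section \<open>Singular values and the two leading eigenvectors\<close>

text \<open>Negating the key turns the increasing sort into a decreasing one. Sorting
  \<open>es\<close> itself keeps the eigenvalues attached to their values under
  \<open>g\<close>.\<close>

lemma rev_sorted_list_of_image_mset:
  "rev (sorted_list_of_multiset (image_mset g (mset es))) = map g (sort_key (\<lambda>z. - g z :: real) es)"
proof -
  let ?s = "sort_key (\<lambda>z. - g z) es"
  have "sorted (map (\<lambda>z. - g z) ?s)" by simp
  then have "sorted (rev (map g ?s))"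
    by (simp add: sorted_wrt_rev sorted_wrt_map)
  then have "sort (map g es) = rev (map g ?s)"
    by (intro properties_for_sort) simp_all
  then show ?thesis by (simp flip: mset_map)
qed

text \<open>The roots of the characteristic polynomial are reordered so that their square roots
  decrease; a Schur decomposition can then be asked for with exactly this diagonal.\<close>

lemma singular_values_eigenvalues:
  assumes A: "A \<in> carrier_mat m n"
  obtains es where "char_poly (mat_adjoint A * A) = (\<Prod>e\<leftarrow>es. [:- e, 1:])" "length es = n"
    "sorted (map (\<lambda>z. - sqrt (Re z)) es)" "singular_values A = take (min m n) (map (\<lambda>z. sqrt (Re z)) es)"
proof -
  let ?C = "mat_adjoint A * A"
  have "?C \<in> carrier_mat n n" using mat_adjoint_carrier[OF A] A by simp
  from char_poly_factorized[OF this] obtain fs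
    where fs: "char_poly ?C = (\<Prod>e\<leftarrow>fs. [:- e, 1:])" "length fs = n" by blast
  define es where "es = sort_key (\<lambda>z. - sqrt (Re z)) fs"
  have es: "mset es = mset fs" by (simp add: es_def)
  have "mset (map (\<lambda>e. [:- e, 1:]) es) = mset (map (\<lambda>e. [:- e, 1:]) fs)" using es by simp
  then have cp: "char_poly ?C = (\<Prod>e\<leftarrow>es. [:- e, 1:])"
    unfolding fs(1) by (metis prod_mset_prod_list)
  have "proots (\<Prod>e\<leftarrow>gs. [:- e, 1:]) = mset gs" for gs :: "complex list"
  proof (induction gs)
    case (Cons g gs)
    have "(\<Prod>e\<leftarrow>gs. [:- e, 1:]) \<noteq> 0" by (induction gs) (auto simp del: mult_pCons_left)
    then show ?case using Cons by (simp add: proots_mult del: mult_pCons_left)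
  qed simp
  then have "singular_values A = take (min m n) (map (\<lambda>z. sqrt (Re z)) es)"
    unfolding singular_values_def fs(1) es_def
    using A by (simp add: rev_sorted_list_of_image_mset)
  moreover have "length es = n" using es fs(2) mset_eq_length by blast
  moreover have "sorted (map (\<lambda>z. - sqrt (Re z)) es)" by (simp add: es_def)
  ultimately show thesis using cp that by blast
qed

text \<open>The first two columns of a Schur basis of the Gram matrix span an invariant subspace;
  as the Gram matrix is Hermitian, orthogonalising the second column against the first
  turns it into an eigenvector.\<close>

lemma leading_gram_eigenvectors:
  assumes A: "A \<in> carrier_mat m n" and m: "m \<ge> 2" and n: "n \<ge> 2"
  obtains v w e\<^sub>0 e\<^sub>1 where "v \<in> carrier_vec n" "w \<in> carrier_vec n" "v \<noteq> 0\<^sub>v n" "w \<noteq> 0\<^sub>v n" "v \<bullet>c w = 0"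
    "mat_adjoint A * A *\<^sub>v v = e\<^sub>0 \<cdot>\<^sub>v v" "mat_adjoint A * A *\<^sub>v w = e\<^sub>1 \<cdot>\<^sub>v w"
    "Re e\<^sub>1 \<le> Re e\<^sub>0" "sigma2 A = sqrt (Re e\<^sub>1)"
proof -
  define C where "C = mat_adjoint A * A"
  have C: "C \<in> carrier_mat n n" using mat_adjoint_carrier[OF A] A by (simp add: C_def)
  obtain es where cp: "char_poly C = (\<Prod>e\<leftarrow>es. [:- e, 1:])" and len: "length es = n"
    and sorted: "sorted (map (\<lambda>z. - sqrt (Re z)) es)"
    and sv: "singular_values A = take (min m n) (map (\<lambda>z. sqrt (Re z)) es)"
    using singular_values_eigenvalues[OF A] unfolding C_def by blast
  \<comment> \<open>The Schur form carries \<open>es\<close> on its diagonal in the given order, so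
    the first two diagonal entries belong to the two largest singular values.\<close>
  obtain B P Q where "schur_decomposition C es = (B, P, Q)" by (rule prod_cases3)
  from schur_decomposition[OF C cp this]
  have wit: "similar_mat_wit C B P Q" and ut: "upper_triangular B" and diag: "diag_mat B = es" by auto
  note w = similar_mat_witD2[OF C wit]
  have B: "B \<in> carrier_mat n n" and P: "P \<in> carrier_mat n n" and Q: "Q \<in> carrier_mat n n"
    and QP: "Q * P = 1\<^sub>m n" and CPBQ: "C = P * B * Q"
    using w by auto
  have CP: "C *\<^sub>v (P *\<^sub>v u) = P *\<^sub>v (B *\<^sub>v u)" if u: "u \<in> carrier_vec n" for u
  proof -
    have "C *\<^sub>v (P *\<^sub>v u) = P *\<^sub>v (B *\<^sub>v (Q *\<^sub>v (P *\<^sub>v u)))"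
      unfolding CPBQ using B P Q u by (simp add: assoc_mult_mat_vec[of _ n n _ n])
    also have "Q *\<^sub>v (P *\<^sub>v u) = u"
      using P Q u QP by (simp flip: assoc_mult_mat_vec)
    finally show ?thesis .
  qed
  have Bdiag: "B $$ (i, i) = es ! i" if "i < n" for i
    using diag that B by (auto simp: diag_mat_def)
  let ?u0 = "unit_vec n 0 :: complex vec" and ?u1 = "unit_vec n 1 :: complex vec"
  define b where "b = B $$ (0, 1)"
  have Bu0: "B *\<^sub>v ?u0 = es ! 0 \<cdot>\<^sub>v ?u0"
  proof (rule eq_vecI)
    fix i assume "i < dim_vec (es ! 0 \<cdot>\<^sub>v ?u0)"
    then have i: "i < n" by simp
    then show "(B *\<^sub>v ?u0) $ i = (es ! 0 \<cdot>\<^sub>v ?u0) $ i"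
      using B n Bdiag[of 0] upper_triangularD[OF ut, of 0 i]
      by (cases "i = 0") (simp_all add: scalar_prod_right_unit)
  qed (use B in simp)
  have Bu1: "B *\<^sub>v ?u1 = b \<cdot>\<^sub>v ?u0 + es ! 1 \<cdot>\<^sub>v ?u1"
  proof (rule eq_vecI)
    fix i assume "i < dim_vec (b \<cdot>\<^sub>v ?u0 + es ! 1 \<cdot>\<^sub>v ?u1)"
    then have i: "i < n" by simp
    consider "i = 0" | "i = 1" | "i > 1" by linarith
    then show "(B *\<^sub>v ?u1) $ i = (b \<cdot>\<^sub>v ?u0 + es ! 1 \<cdot>\<^sub>v ?u1) $ i"
      using i B n Bdiag[of 1] upper_triangularD[OF ut, of 1 i]
      by cases (simp_all add: scalar_prod_right_unit b_def)
  qed (use B in simp)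
  define v where "v = P *\<^sub>v ?u0"
  define p where "p = P *\<^sub>v ?u1"
  have v: "v \<in> carrier_vec n" and p: "p \<in> carrier_vec n" using P by (auto simp: v_def p_def)
  have Cv: "C *\<^sub>v v = es ! 0 \<cdot>\<^sub>v v"
    using CP[of ?u0] P by (simp add: v_def Bu0 mult_mat_vec)
  have Cp: "C *\<^sub>v p = b \<cdot>\<^sub>v v + es ! 1 \<cdot>\<^sub>v p"
    using CP[of ?u1] P by (simp add: v_def p_def Bu1[unfolded One_nat_def] mult_mat_vec mult_add_distrib_mat_vec[of _ n n])
  have Qv: "Q *\<^sub>v v = ?u0" and Qp: "Q *\<^sub>v p = ?u1"
    using P Q QP by (simp_all add: v_def p_def flip: assoc_mult_mat_vec)
  have Q0: "Q *\<^sub>v 0\<^sub>v n = 0\<^sub>v n" using Q by (intro eq_vecI) simp_all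
  have v0: "v \<noteq> 0\<^sub>v n"
  proof
    assume "v = 0\<^sub>v n"
    then have "?u0 = 0\<^sub>v n" using Qv Q0 by simp
    then have "?u0 $ 0 = (0\<^sub>v n :: complex vec) $ 0" by simp
    then show False using n by simp
  qed
  define r where "r = p \<bullet>c v / (v \<bullet>c v)"
  define w where "w = p + (- r) \<cdot>\<^sub>v v"
  have w: "w \<in> carrier_vec n" using v p by (simp add: w_def)
  have vv: "v \<bullet>c v \<noteq> 0" using v v0 by simp
  have wv: "w \<bullet>c v = 0"
    using v p vv by (simp add: w_def add_scalar_prod_distrib[of _ n] r_def)
  then have vw: "v \<bullet>c w = 0" using scalar_prod_conjugate_commute[OF v w] by simp
  \<comment> \<open>The coordinate of \<open>Q w\<close> at index 1 is 1, since subtracting a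
    multiple of \<open>v\<close> affects only index 0.\<close>
  have w0: "w \<noteq> 0\<^sub>v n"
  proof
    assume "w = 0\<^sub>v n"
    then have "Q *\<^sub>v w = 0\<^sub>v n" using Q0 by simp
    moreover have "Q *\<^sub>v w = ?u1 + (- r) \<cdot>\<^sub>v ?u0"
      using Q v p by (simp add: w_def mult_add_distrib_mat_vec[of _ n n] mult_mat_vec[of _ n n] Qv Qp)
    ultimately have "(?u1 + (- r) \<cdot>\<^sub>v ?u0) $ 1 = (0\<^sub>v n :: complex vec) $ 1" by simp
    then show False using n by simp
  qed
  \<comment> \<open>Substituting \<open>p = w + r v\<close> into \<open>C p - r C v\<close> leaves
    this coefficient at \<open>v\<close>. It will vanish because \<open>C\<close> is Hermitian and
    \<open>w\<close> is orthogonal to the eigenvector \<open>v\<close>.\<close>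
  define s where "s = b + r * es ! 1 - r * es ! 0"
  have Cw: "C *\<^sub>v w = s \<cdot>\<^sub>v v + es ! 1 \<cdot>\<^sub>v w"
  proof -
    have "C *\<^sub>v w = (b \<cdot>\<^sub>v v + es ! 1 \<cdot>\<^sub>v p) + (- r) \<cdot>\<^sub>v (es ! 0 \<cdot>\<^sub>v v)"
      using C v p by (simp add: w_def mult_add_distrib_mat_vec[of _ n n] mult_mat_vec[of _ n n] Cv Cp)
    also have "\<dots> = s \<cdot>\<^sub>v v + es ! 1 \<cdot>\<^sub>v w"
      using v p by (intro eq_vecI) (simp_all add: w_def s_def algebra_simps)
    finally show ?thesis .
  qed
  have "(C *\<^sub>v w) \<bullet>c v = 0"
  proof -
    have "(C *\<^sub>v w) \<bullet>c v = cnj ((A *\<^sub>v v) \<bullet>c (A *\<^sub>v w))"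
      using gram_scalar_prod[OF A w v] scalar_prod_conjugate_commute[of "A *\<^sub>v w" m "A *\<^sub>v v"] A v w
      by (simp add: C_def)
    also have "\<dots> = cnj ((C *\<^sub>v v) \<bullet>c w)" by (simp add: C_def gram_scalar_prod[OF A v w])
    also have "\<dots> = 0" using v w vw by (simp add: Cv)
    finally show ?thesis .
  qed
  then have "s = 0" using v w vv wv by (simp add: Cw add_scalar_prod_distrib[of _ n])
  then have Cw': "C *\<^sub>v w = es ! 1 \<cdot>\<^sub>v w" using v w by (intro eq_vecI) (simp_all add: Cw)
  have "- sqrt (Re (es ! 0)) \<le> - sqrt (Re (es ! 1))"
    using sorted_nth_mono[OF sorted, of 0 1] len n by simp
  \<comment> \<open>\<open>sqrt\<close> is odd and increasing on all reals, so the order passes to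
    the radicands whatever their sign.\<close>
  then have "Re (es ! 1) \<le> Re (es ! 0)" by simp
  \<comment> \<open>Both dimensions are at least 2, so index 1 survives the truncation to
    \<open>min m n\<close> entries.\<close>
  moreover have "sigma2 A = sqrt (Re (es ! 1))"
    using m n len by (simp add: sigma2_def sv)
  ultimately show thesis
    using that[OF v w v0 w0 vw] Cv Cw' unfolding C_def by blast
qed

text \<open>The plane of \<open>v\<close> and \<open>w\<close> meets the hyperplane of vectors with
  sum zero, and \<open>A\<close> stretches every vector of that plane by at least
  \<open>sigma2 A\<close>, because \<open>v\<close> and \<open>w\<close> are orthogonal and so are
  their images.\<close>

lemma sigma2_le_norm_on_kernel:
  fixes A :: "complex mat"
  assumes A: "A \<in> carrier_mat m n" and m: "m \<ge> 2" and n: "n \<ge> 2"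
  obtains y where "y \<in> carrier_vec n" "norm_square y > 0" "(\<Sum>j<n. y $ j) = 0"
    "(sigma2 A)\<^sup>2 * norm_square y \<le> norm_square (A *\<^sub>v y)" "sigma2 A \<ge> 0"
proof -
  obtain v w e\<^sub>0 e\<^sub>1 where v: "v \<in> carrier_vec n" and w: "w \<in> carrier_vec n"
    and v0: "v \<noteq> 0\<^sub>v n" and w0: "w \<noteq> 0\<^sub>v n" and orth: "v \<bullet>c w = 0"
    and ev: "mat_adjoint A * A *\<^sub>v v = e\<^sub>0 \<cdot>\<^sub>v v" and ew: "mat_adjoint A * A *\<^sub>v w = e\<^sub>1 \<cdot>\<^sub>v w"
    and le: "Re e\<^sub>1 \<le> Re e\<^sub>0" and s: "sigma2 A = sqrt (Re e\<^sub>1)"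
    using leading_gram_eigenvectors[OF A m n] by blast
  have "0 \<le> Re e\<^sub>1 * norm_square w"
    using norm_square_eigenvector[OF A w ew] norm_square_nonneg by metis
  then have e1: "Re e\<^sub>1 \<ge> 0"
    using norm_square_pos[OF w w0] by (simp add: zero_le_mult_iff)
  \<comment> \<open>One linear equation in two unknowns: if the sum of \<open>v\<close> vanishes,
    \<open>v\<close> itself serves; otherwise the two sums are taken crosswise, one of them
    negated.\<close>
  obtain \<alpha> \<beta> where ab: "\<alpha> * (\<Sum>j<n. v $ j) + \<beta> * (\<Sum>j<n. w $ j) = 0" "\<alpha> \<noteq> 0 \<or> \<beta> \<noteq> 0"
  proof (cases "(\<Sum>j<n. v $ j) = 0")
    case True
    then show thesis using that[of 1 0] by simp
  next
    case False
    then show thesis using that[of "\<Sum>j<n. w $ j" "- (\<Sum>j<n. v $ j)"] by simp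
  qed
  define y where "y = \<alpha> \<cdot>\<^sub>v v + \<beta> \<cdot>\<^sub>v w"
  have y: "y \<in> carrier_vec n" using v w by (simp add: y_def)
  have nsy: "norm_square y = (cmod \<alpha>)\<^sup>2 * norm_square v + (cmod \<beta>)\<^sup>2 * norm_square w"
    unfolding y_def by (rule norm_square_orthogonal_combination[OF v w orth])
  have "norm_square y > 0"
    using ab(2) norm_square_pos[OF v v0] norm_square_pos[OF w w0] unfolding nsy
    by (auto intro: add_pos_nonneg add_nonneg_pos)
  moreover have "(\<Sum>j<n. y $ j) = 0"
  proof -
    have "(\<Sum>j<n. y $ j) = (\<Sum>j<n. \<alpha> * v $ j + \<beta> * w $ j)"
      using v w by (intro sum.cong) (auto simp: y_def)
    then show ?thesis using ab(1) by (simp add: sum.distrib sum_distrib_left)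
  qed
  moreover have "(sigma2 A)\<^sup>2 * norm_square y \<le> norm_square (A *\<^sub>v y)"
  proof -
    have "(A *\<^sub>v v) \<bullet>c (A *\<^sub>v w) = 0"
      using v w orth by (simp add: ev flip: gram_scalar_prod[OF A v w])
    moreover have "A *\<^sub>v y = \<alpha> \<cdot>\<^sub>v (A *\<^sub>v v) + \<beta> \<cdot>\<^sub>v (A *\<^sub>v w)"
      using A v w by (simp add: y_def mult_add_distrib_mat_vec[of _ m n] mult_mat_vec[of _ m n])
    ultimately have "norm_square (A *\<^sub>v y)
      = (cmod \<alpha>)\<^sup>2 * (Re e\<^sub>0 * norm_square v) + (cmod \<beta>)\<^sup>2 * (Re e\<^sub>1 * norm_square w)"
      using norm_square_orthogonal_combination[of "A *\<^sub>v v" m "A *\<^sub>v w"] A v w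
      by (simp add: norm_square_eigenvector[OF A v ev] norm_square_eigenvector[OF A w ew])
    also have "\<dots> \<ge> (cmod \<alpha>)\<^sup>2 * (Re e\<^sub>1 * norm_square v) + (cmod \<beta>)\<^sup>2 * (Re e\<^sub>1 * norm_square w)"
      by (intro add_right_mono mult_left_mono mult_right_mono le norm_square_nonneg) simp
    finally show ?thesis by (simp add: s e1 nsy algebra_simps)
  qed
  moreover have "sigma2 A \<ge> 0" by (simp add: s e1)
  ultimately show thesis using that y by blast
qed

section \<open>Rank and number of rows\<close>

text \<open>A maximal independent set of columns lies in a space of dimension \<open>n\<close>,
  which is the number of rows here.\<close>

lemma (in vec_space) rank_le_dim_row:
  assumes A: "A \<in> carrier_mat n nc"
  shows "rank A \<le> n"
proof -
  have "finite (set (cols A))" by simp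
  then obtain S where S: "maximal S (\<lambda>T. T \<subseteq> set (cols A) \<and> lin_indpt T)"
    using maximal_exists_superset[of "set (cols A)" "\<lambda>T. T \<subseteq> set (cols A) \<and> lin_indpt T" "{}"]
      finite_lin_indpt2 by auto
  then have "S \<subseteq> set (cols A)" "lin_indpt S" by (auto simp: maximal_def)
  then have "card S \<le> dim" using cols_dim[of A] A by (intro li_le_dim(2)) auto
  then show ?thesis using rank_card_indpt[OF A S] dim_is_n by simp
qed

section \<open>Zero-one vectors and the cut bound\<close>

definition indicator_vec :: "nat \<Rightarrow> nat set \<Rightarrow> complex vec" where
  "indicator_vec k S = vec k (\<lambda>i. of_bool (i \<in> S))"

text \<open>A zero-one vector is determined by its support. Finiteness makes the maximum in
  \<open>norm_P\<close> an upper bound.\<close>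

lemma finite_zero_one_vecs: "finite (zero_one_vecs k)"
proof (rule finite_subset)
  show "zero_one_vecs k \<subseteq> indicator_vec k ` Pow {..<k}"
  proof
    fix v assume v: "v \<in> zero_one_vecs k"
    then have "v = indicator_vec k {i\<in>{..<k}. v $ i = 1}"
      by (intro eq_vecI) (auto simp: zero_one_vecs_def indicator_vec_def)
    then show "v \<in> indicator_vec k ` Pow {..<k}" by blast
  qed
qed simp

lemma indicator_vec_in_zero_one_vecs:
  assumes "S \<subseteq> {..<k}" "S \<noteq> {}"
  shows "indicator_vec k S \<in> zero_one_vecs k"
proof -
  obtain i where i: "i \<in> S" "i < k" using assms by auto
  have "indicator_vec k S \<noteq> 0\<^sub>v k"
  proof
    assume "indicator_vec k S = 0\<^sub>v k"
    then have "indicator_vec k S $ i = 0\<^sub>v k $ i" by simp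
    then show False using i by (simp add: indicator_vec_def)
  qed
  then show ?thesis by (simp add: zero_one_vecs_def indicator_vec_def)
qed

lemma sum_indicator_vec:
  fixes k :: nat
  assumes "S \<subseteq> {..<k}"
  shows "(\<Sum>i<k. of_bool (i \<in> S) * g i) = (\<Sum>i\<in>S. (g i :: 'a::semiring_1))"
  using assms by (intro sum.mono_neutral_cong_right) auto

lemma euclid_norm_indicator_vec:
  assumes "S \<subseteq> {..<k}"
  shows "euclid_norm (indicator_vec k S) = sqrt (card S)"
proof -
  have "(\<Sum>i<k. (cmod (indicator_vec k S $ i))\<^sup>2) = (\<Sum>i\<in>S. 1)"
    using assms by (intro sum.mono_neutral_cong_right) (auto simp: indicator_vec_def)
  moreover have "dim_vec (indicator_vec k S) = k" by (simp add: indicator_vec_def)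
  ultimately show ?thesis by (simp add: euclid_norm_def)
qed

text \<open>The indicator vectors of \<open>S\<close> and \<open>T\<close> are admissible test
  vectors unless one of the sets is empty, and then both sides are 0.\<close>

lemma norm_P_cut:
  assumes B: "B \<in> carrier_mat m n" and S: "S \<subseteq> {..<m}" and T: "T \<subseteq> {..<n}"
  shows "cmod (\<Sum>i\<in>S. \<Sum>j\<in>T. B $$ (i, j)) \<le> norm_P B * (sqrt (card S) * sqrt (card T))"
proof (cases "S = {} \<or> T = {}")
  case True
  then show ?thesis by auto
next
  case False
  let ?q = "\<lambda>(\<xi>, \<eta>). cmod (\<xi> \<bullet> (B *\<^sub>v \<eta>)) / (euclid_norm \<xi> * euclid_norm \<eta>)"
  have "(indicator_vec m S, indicator_vec n T) \<in> zero_one_vecs m \<times> zero_one_vecs n"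
    using False S T by (simp add: indicator_vec_in_zero_one_vecs)
  then have "?q (indicator_vec m S, indicator_vec n T) \<le> norm_P B"
    unfolding norm_P_def using B
    by (intro Max_ge finite_imageI finite_cartesian_product finite_zero_one_vecs) auto
  moreover have "indicator_vec m S \<bullet> (B *\<^sub>v indicator_vec n T) = (\<Sum>i\<in>S. \<Sum>j\<in>T. B $$ (i, j))"
  proof -
    have "indicator_vec m S \<bullet> (B *\<^sub>v indicator_vec n T)
      = (\<Sum>i<m. of_bool (i \<in> S) * (\<Sum>j<n. of_bool (j \<in> T) * B $$ (i, j)))"
      using B by (simp add: scalar_prod_def indicator_vec_def lessThan_atLeast0 mult.commute)
    then show ?thesis by (simp only: sum_indicator_vec[OF S] sum_indicator_vec[OF T])
  qed
  moreover have "0 < sqrt (card S) * sqrt (card T)"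
    using False finite_subset[OF S] finite_subset[OF T] by (simp add: card_gt_0_iff)
  ultimately show ?thesis
    by (simp add: euclid_norm_indicator_vec[OF S] euclid_norm_indicator_vec[OF T] divide_le_eq)
qed

lemma norm_P_nonneg:
  assumes "B \<in> carrier_mat m n" "m > 0" "n > 0"
  shows "norm_P B \<ge> 0"
proof -
  have "cmod (\<Sum>i\<in>{0}. \<Sum>j\<in>{0}. B $$ (i, j)) \<le> norm_P B * (sqrt (card {0::nat}) * sqrt (card {0::nat}))"
    using assms by (intro norm_P_cut[of B m n]) auto
  from order.trans[OF norm_ge_zero this] show ?thesis by simp
qed

section \<open>Row and column sums of the centred matrix\<close>

lemma column_sum_le_norm_one:
  assumes "A \<in> carrier_mat m n" "j < n"
  shows "(\<Sum>i<m. cmod (A $$ (i, j))) \<le> norm_one A"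
  using assms unfolding norm_one_def by (intro Max_ge) auto

lemma row_sum_le_norm_infty:
  assumes "A \<in> carrier_mat m n" "i < m"
  shows "(\<Sum>j<n. cmod (A $$ (i, j))) \<le> norm_infty A"
  using assms unfolding norm_infty_def by (intro Max_ge) auto

text \<open>The modulus of the mean is at most the total of the moduli divided by
  \<open>m * n\<close>; bounding this total by rows gives the first estimate, by columns the
  second.\<close>

lemma mean_mat_entry_bounds:
  assumes A: "A \<in> carrier_mat m n" and i: "i < m" and j: "j < n"
  shows "n * cmod (mean_mat A $$ (i, j)) \<le> norm_infty A" "m * cmod (mean_mat A $$ (i, j)) \<le> norm_one A"
proof -
  let ?s = "\<Sum>i<m. \<Sum>j<n. cmod (A $$ (i, j))"
  have "cmod (\<Sum>i<m. \<Sum>j<n. A $$ (i, j)) \<le> ?s"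
    by (intro sum_norm_le order_refl)
  then have le: "cmod (mean_mat A $$ (i, j)) \<le> ?s / (m * n)"
    using A i j by (simp add: mean_mat_def norm_divide norm_mult divide_right_mono)
  have "?s \<le> (\<Sum>i<m. norm_infty A)"
    by (intro sum_mono row_sum_le_norm_infty[OF A]) simp
  then have s1: "?s \<le> m * norm_infty A" by simp
  have "?s = (\<Sum>j<n. \<Sum>i<m. cmod (A $$ (i, j)))" by (rule sum.swap)
  also have "\<dots> \<le> (\<Sum>j<n. norm_one A)"
    by (intro sum_mono column_sum_le_norm_one[OF A]) simp
  finally have s2: "?s \<le> n * norm_one A" by simp
  have "n * cmod (mean_mat A $$ (i, j)) \<le> n * (?s / (m * n))"
    by (intro mult_left_mono le) simp
  also have "\<dots> = ?s / m" using j by simp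
  also have "\<dots> \<le> norm_infty A" using s1 i by (simp add: divide_le_eq mult.commute)
  finally show "n * cmod (mean_mat A $$ (i, j)) \<le> norm_infty A" .
  have "m * cmod (mean_mat A $$ (i, j)) \<le> m * (?s / (m * n))"
    by (intro mult_left_mono le) simp
  also have "\<dots> = ?s / n" using i by simp
  also have "\<dots> \<le> norm_one A" using s2 j by (simp add: divide_le_eq mult.commute)
  finally show "m * cmod (mean_mat A $$ (i, j)) \<le> norm_one A" .
qed

lemma minus_mean_mat_column_sum_le:
  assumes A: "A \<in> carrier_mat m n" and j: "j < n"
  shows "(\<Sum>i<m. cmod ((A - mean_mat A) $$ (i, j))) \<le> 2 * norm_one A"
proof (cases "m = 0")
  case True
  then show ?thesis using column_sum_le_norm_one[OF A j] by simp
next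
  case False
  \<comment> \<open>All entries of the mean matrix agree, so the row index may be fixed to
    0.\<close>
  have "(\<Sum>i<m. cmod ((A - mean_mat A) $$ (i, j))) \<le> (\<Sum>i<m. cmod (A $$ (i, j)) + cmod (mean_mat A $$ (0, j)))"
    using A j by (intro sum_mono) (auto simp: mean_mat_def intro!: norm_triangle_ineq4)
  also have "\<dots> = (\<Sum>i<m. cmod (A $$ (i, j))) + m * cmod (mean_mat A $$ (0, j))" by (simp add: sum.distrib)
  also have "\<dots> \<le> norm_one A + norm_one A"
    using False by (intro add_mono column_sum_le_norm_one[OF A j] mean_mat_entry_bounds(2)[OF A _ j]) simp
  finally show ?thesis by simp
qed

lemma minus_mean_mat_row_sum_le:
  assumes A: "A \<in> carrier_mat m n" and i: "i < m"
  shows "(\<Sum>j<n. cmod ((A - mean_mat A) $$ (i, j))) \<le> 2 * norm_infty A"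
proof (cases "n = 0")
  case True
  then show ?thesis using row_sum_le_norm_infty[OF A i] by simp
next
  case False
  have "(\<Sum>j<n. cmod ((A - mean_mat A) $$ (i, j))) \<le> (\<Sum>j<n. cmod (A $$ (i, j)) + cmod (mean_mat A $$ (i, 0)))"
    using A i by (intro sum_mono) (auto simp: mean_mat_def intro!: norm_triangle_ineq4)
  also have "\<dots> = (\<Sum>j<n. cmod (A $$ (i, j))) + n * cmod (mean_mat A $$ (i, 0))" by (simp add: sum.distrib)
  also have "\<dots> \<le> norm_infty A + norm_infty A"
    using False by (intro add_mono row_sum_le_norm_infty[OF A i] mean_mat_entry_bounds(1)[OF A i]) simp
  finally show ?thesis by simp
qed

text \<open>Each row of the mean matrix is constant, so its product with \<open>y\<close> is a
  multiple of the coordinate sum.\<close>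

lemma minus_mean_mat_mult_vec:
  assumes A: "A \<in> carrier_mat m n" and y: "y \<in> carrier_vec n" and zero: "(\<Sum>j<n. y $ j) = 0"
  shows "(A - mean_mat A) *\<^sub>v y = A *\<^sub>v y"
proof -
  have M: "mean_mat A \<in> carrier_mat m n" using A by (simp add: mean_mat_def)
  have "mean_mat A *\<^sub>v y = 0\<^sub>v m"
    using A y zero
    by (intro eq_vecI) (auto simp: mean_mat_def scalar_prod_def lessThan_atLeast0 simp flip: sum_divide_distrib sum_distrib_left)
  then show ?thesis
    using A M y minus_mult_distrib_mat_vec[OF A M y] by simp
qed

section \<open>From the form bound to the final estimate\<close>

text \<open>Test the form on the conjugate of \<open>B y\<close> and on \<open>y\<close>, both
  scaled to norm 1: the form becomes the quotient of the two norms, and the sum of squares on the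
  right becomes 2.\<close>

lemma sqrt_norm_square_mult_vec_le:
  fixes B :: "complex mat"
  assumes B: "B \<in> carrier_mat m n" and y: "y \<in> carrier_vec n"
    and pos: "norm_square y > 0" "norm_square (B *\<^sub>v y) > 0"
    and bound: "\<And>x y. cmod (\<Sum>i<m. \<Sum>j<n. x i * B $$ (i, j) * y j)
      \<le> \<kappa> * ((\<Sum>i<m. (cmod (x i))\<^sup>2) + (\<Sum>j<n. (cmod (y j))\<^sup>2))"
  shows "sqrt (norm_square (B *\<^sub>v y)) \<le> 2 * \<kappa> * sqrt (norm_square y)"
proof -
  define N where "N = sqrt (norm_square (B *\<^sub>v y))"
  define Y where "Y = sqrt (norm_square y)"
  have N: "N > 0" "N\<^sup>2 = norm_square (B *\<^sub>v y)" and Y: "Y > 0" "Y\<^sup>2 = norm_square y"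
    using pos by (simp_all add: N_def Y_def)
  let ?x = "\<lambda>i. cnj ((B *\<^sub>v y) $ i) / of_real N" and ?y = "\<lambda>j. y $ j / of_real Y"
  have row: "(\<Sum>j<n. B $$ (i, j) * y $ j) = (B *\<^sub>v y) $ i" if "i < m" for i
    using B y that by (simp add: scalar_prod_def lessThan_atLeast0)
  have "(\<Sum>i<m. \<Sum>j<n. ?x i * B $$ (i, j) * ?y j)
    = (\<Sum>i<m. cnj ((B *\<^sub>v y) $ i) * (\<Sum>j<n. B $$ (i, j) * y $ j)) / (of_real N * of_real Y)"
    by (simp add: sum_divide_distrib sum_distrib_left mult_ac)
  also have "(\<Sum>i<m. cnj ((B *\<^sub>v y) $ i) * (\<Sum>j<n. B $$ (i, j) * y $ j))
    = (\<Sum>i<m. of_real ((cmod ((B *\<^sub>v y) $ i))\<^sup>2))"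
  proof (rule sum.cong)
    fix i assume "i \<in> {..<m}"
    then have "(\<Sum>j<n. B $$ (i, j) * y $ j) = (B *\<^sub>v y) $ i" by (simp only: row lessThan_iff)
    then show "cnj ((B *\<^sub>v y) $ i) * (\<Sum>j<n. B $$ (i, j) * y $ j) = of_real ((cmod ((B *\<^sub>v y) $ i))\<^sup>2)"
      by (simp only: complex_norm_square mult.commute)
  qed simp
  also have "\<dots> = of_real (N\<^sup>2)"
    using B by (simp add: N(2) norm_square_def)
  also have "of_real (N\<^sup>2) / (of_real N * of_real Y) = complex_of_real (N / Y)"
    using N(1) by (simp add: power2_eq_square)
  finally have form: "(\<Sum>i<m. \<Sum>j<n. ?x i * B $$ (i, j) * ?y j) = complex_of_real (N / Y)" .
  have "(\<Sum>i<m. (cmod (?x i))\<^sup>2) = (\<Sum>i<m. (cmod ((B *\<^sub>v y) $ i))\<^sup>2) / N\<^sup>2"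
    by (simp add: norm_divide power_divide sum_divide_distrib)
  also have "(\<Sum>i<m. (cmod ((B *\<^sub>v y) $ i))\<^sup>2) = N\<^sup>2" using B by (simp add: N(2) norm_square_def)
  finally have x1: "(\<Sum>i<m. (cmod (?x i))\<^sup>2) = 1" using N(1) by simp
  have "(\<Sum>j<n. (cmod (?y j))\<^sup>2) = (\<Sum>j<n. (cmod (y $ j))\<^sup>2) / Y\<^sup>2"
    by (simp add: norm_divide power_divide sum_divide_distrib)
  also have "(\<Sum>j<n. (cmod (y $ j))\<^sup>2) = Y\<^sup>2" using y by (simp add: Y(2) norm_square_def)
  finally have y1: "(\<Sum>j<n. (cmod (?y j))\<^sup>2) = 1" using Y(1) by simp
  have "N / Y \<le> \<kappa> * (1 + 1)"
    using bound[of ?x ?y] N(1) Y(1) unfolding form x1 y1 by (simp add: norm_divide)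
  then show ?thesis using Y by (simp add: N_def[symmetric] Y_def[symmetric] divide_le_eq mult_ac)
qed

lemma le_mult_power_int_ceiling_log:
  fixes q \<delta> :: real
  assumes "q > 0" "\<delta> > 0"
  shows "q \<le> \<delta> * 2 powi \<lceil>log 2 (q / \<delta>)\<rceil>"
proof -
  have "q / \<delta> = 2 powr log 2 (q / \<delta>)" using assms by simp
  also have "\<dots> \<le> 2 powr of_int \<lceil>log 2 (q / \<delta>)\<rceil>" by (intro powr_mono) simp_all
  also have "\<dots> = 2 powi \<lceil>log 2 (q / \<delta>)\<rceil>" by (simp add: powr_real_of_int')
  finally show ?thesis using assms by (simp add: divide_le_eq mult.commute)
qed

text \<open>With \<open>x = ln K + 11/2 * ln 2\<close> the window length is at most
  \<open>2 * x / ln 2\<close>. Now \<open>ln 2 >= 1/2\<close> bounds this by \<open>4 * x\<close>,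
  and \<open>11 * ln 2 <= 8\<close> bounds \<open>x\<close> by \<open>ln K + 4\<close>. This gives 8
  * 4 = 32; the factor \<open>sqrt 2\<close> is slack.\<close>

lemma window_log_bound:
  fixes s P K :: real and c d :: int
  assumes s: "s > 0" and P: "P \<ge> 0" and K: "K > 0"
    and window: "s \<le> 8 * P * nat (c + d + 1)" "real_of_int (c + d + 1) \<le> 2 * log 2 K + 11"
  shows "s / (32 * sqrt 2 * (ln K + 4)) \<le> P"
proof -
  have "(1 / 2 :: real) \<le> ln 2" using ln_add_one_self_le_self2[of "- (1/2)"] by (simp add: ln_div)
  \<comment> \<open>\<open>(12/11) ^ 8\<close> barely exceeds 2, which yields
    \<open>ln 2 <= 8/11\<close>.\<close>
  have "(2::real) \<le> (1 + (8/11) / real 8) ^ 8" by (simp add: power_divide eval_nat_numeral)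
  also have "\<dots> \<le> exp (8/11)" by (rule exp_ge_one_plus_x_over_n_power_n) simp_all
  finally have "ln 2 \<le> ln (exp (8/11 :: real))" by (subst ln_le_cancel_iff) simp_all
  then have ln2: "11 * ln 2 \<le> (8::real)" by simp
  \<comment> \<open>The window cannot be empty, as \<open>s\<close> is positive; this is also what
    makes \<open>ln K + 4\<close> positive.\<close>
  have "nat (c + d + 1) \<noteq> 0" using window(1) s by (intro notI) simp
  then have w: "c + d + 1 > 0" by simp
  define x where "x = ln K + 11 / 2 * ln 2"
  have log_K: "2 * log 2 K + 11 = 2 * x / ln 2" by (simp add: x_def log_def field_simps)
  have "0 < 2 * x / ln 2" using w window(2) unfolding log_K by linarith
  then have x: "x > 0" by (simp add: zero_less_divide_iff)
  have x_le: "x \<le> ln K + 4" using ln2 by (simp add: x_def)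
  have "2 * x \<le> 4 * x * ln 2" using x \<open>1 / 2 \<le> ln 2\<close> by simp
  then have "2 * x / ln 2 \<le> 4 * x" by (simp add: divide_le_eq)
  then have le: "2 * log 2 K + 11 \<le> 4 * (ln K + 4)" 
    unfolding log_K by (rule order.trans) (use x_le in simp)
  have pos: "ln K + 4 > 0" using x x_le by linarith
  have "s \<le> 8 * P * real_of_int (c + d + 1)" using window(1) w by simp
  also have "\<dots> \<le> 8 * P * (4 * (ln K + 4))"
    by (intro mult_left_mono) (use window(2) le P in simp_all)
  also have "\<dots> = P * (32 * (ln K + 4))" by simp
  also have "\<dots> \<le> P * (32 * sqrt 2 * (ln K + 4))"
    using pos by (intro mult_left_mono mult_right_mono P) simp_all
  finally show ?thesis using pos by (simp add: divide_le_eq)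
qed

theorem theorem4:
  fixes A :: "complex mat" and m n :: nat and K :: real
  assumes "A \<in> carrier_mat m n"
    and "vec_space.rank m A \<ge> 2"
    and "K = 2 * sqrt (norm_one A * norm_infty A) / sigma2 A"
  shows "norm_P (A - mean_mat A) \<ge> sigma2 A / (32 * sqrt 2 * (ln K + 4))"
proof -
  note A = assms(1)
  have m: "m \<ge> 2" using vec_space.rank_le_dim_row[OF A] assms(2) by linarith
  have n: "n \<ge> 2" using vec_space.rank_le_nc[OF A] assms(2) by linarith
  define s where "s = sigma2 A"
  define B where "B = A - mean_mat A"
  define P where "P = norm_P B"
  have B: "B \<in> carrier_mat m n" unfolding B_def mean_mat_def using A by (intro minus_carrier_mat) simp
  have P: "P \<ge> 0" unfolding P_def by (rule norm_P_nonneg[OF B]) (use m n in auto)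
  obtain y where y: "y \<in> carrier_vec n" and y0: "norm_square y > 0" and zero: "(\<Sum>j<n. y $ j) = 0"
    and le: "s\<^sup>2 * norm_square y \<le> norm_square (A *\<^sub>v y)" and "s \<ge> 0"
    using sigma2_le_norm_on_kernel[OF A m n] unfolding s_def by blast
  show ?thesis
  proof (cases "s = 0")
    case True
    then show ?thesis using P by (simp add: P_def B_def s_def)
  next
    case False
    with \<open>s \<ge> 0\<close> have s: "s > 0" by simp
    have Ay: "norm_square (A *\<^sub>v y) > 0"
      using le s y0 by (meson less_le_trans mult_pos_pos zero_less_power)
    \<comment> \<open>A nonzero entry makes both norms positive, as the logarithms below
      require.\<close>
    obtain i j where ij: "i < m" "j < n" "A $$ (i, j) \<noteq> 0"
    proof (rule ccontr)
      assume "\<not> thesis"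
      with that have "A $$ (i, j) = 0" if "i < m" "j < n" for i j using that by blast
      then have "norm_square (A *\<^sub>v y) = 0"
        using A y by (simp add: norm_square_def scalar_prod_def)
      with Ay show False by simp
    qed
    have Aij: "0 < cmod (A $$ (i, j))" using ij(3) by simp
    have N1: "norm_one A > 0"
    proof -
      have "cmod (A $$ (i, j)) \<le> (\<Sum>i<m. cmod (A $$ (i, j)))"
        by (rule member_le_sum) (use ij in auto)
      then show ?thesis using column_sum_le_norm_one[OF A ij(2)] Aij by linarith
    qed
    have Ni: "norm_infty A > 0"
    proof -
      have "cmod (A $$ (i, j)) \<le> (\<Sum>j<n. cmod (A $$ (i, j)))"
        by (rule member_le_sum) (use ij in auto)
      then show ?thesis using row_sum_le_norm_infty[OF A ij(1)] Aij by linarith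
    qed
    have K: "K > 0" "K = 2 * sqrt (norm_one A * norm_infty A) / s"
      using assms(3) N1 Ni s by (simp_all add: s_def)
    \<comment> \<open>The tail then contributes \<open>8 * \<delta> = s / 2\<close> to the final
      bound \<open>8 * \<kappa>\<close>, so half of \<open>s\<close> remains for the window.\<close>
    define \<delta> where "\<delta> = s / 16"
    have \<delta>: "\<delta> > 0" using s by (simp add: \<delta>_def)
    define c where "c = \<lceil>log 2 (2 * norm_one A / \<delta>)\<rceil>"
    define d where "d = \<lceil>log 2 (2 * norm_infty A / \<delta>)\<rceil>"
    define \<kappa> where "\<kappa> = P * nat (c + d + 1) / 2 + \<delta>"
    have "cmod (\<Sum>i<m. \<Sum>j<n. of_nat (u i) * B $$ (i, j) * of_nat (v j))
      \<le> \<kappa> * ((\<Sum>i<m. (real (u i))\<^sup>2) + (\<Sum>j<n. (real (v j))\<^sup>2))" for u v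
      unfolding \<kappa>_def
    proof (rule bilinear_form_bound_nat)
      show "2 * norm_one A \<le> \<delta> * 2 powi c" "2 * norm_infty A \<le> \<delta> * 2 powi d"
        unfolding c_def d_def by (rule le_mult_power_int_ceiling_log; use N1 Ni \<delta> in simp)+
    qed (use P \<delta> B_def norm_P_cut[OF B] minus_mean_mat_column_sum_le[OF A] minus_mean_mat_row_sum_le[OF A]
        in \<open>auto simp: P_def\<close>)
    then have "cmod (\<Sum>i<m. \<Sum>j<n. x i * B $$ (i, j) * z j)
      \<le> 4 * \<kappa> * ((\<Sum>i<m. (cmod (x i))\<^sup>2) + (\<Sum>j<n. (cmod (z j))\<^sup>2))" for x z
      by (intro bilinear_form_bound_complex bilinear_form_bound_nonneg)
    moreover have By: "B *\<^sub>v y = A *\<^sub>v y"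
      unfolding B_def by (rule minus_mean_mat_mult_vec[OF A y zero])
    \<comment> \<open>The 4 comes from the complex splitting and the 2 from the two unit
      vectors.\<close>
    ultimately have "sqrt (norm_square (A *\<^sub>v y)) \<le> 2 * (4 * \<kappa>) * sqrt (norm_square y)"
      using sqrt_norm_square_mult_vec_le[OF B y y0, of "4 * \<kappa>"] Ay by simp
    moreover have "s * sqrt (norm_square y) \<le> sqrt (norm_square (A *\<^sub>v y))"
      using real_sqrt_le_mono[OF le] s by (simp add: real_sqrt_mult)
    ultimately have "s * sqrt (norm_square y) \<le> 8 * \<kappa> * sqrt (norm_square y)" by linarith
    then have "s \<le> 8 * \<kappa>" using y0 by simp
    then have w1: "s \<le> 8 * P * nat (c + d + 1)" by (simp add: \<kappa>_def \<delta>_def)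
    \<comment> \<open>Each of the two ceilings costs at most 1, and the window count adds 1.\<close>
    have "real_of_int (c + d + 1) \<le> log 2 (2 * norm_one A / \<delta>) + log 2 (2 * norm_infty A / \<delta>) + 3"
      unfolding c_def d_def by simp linarith
    also have "\<dots> = log 2 (2 * norm_one A / \<delta> * (2 * norm_infty A / \<delta>)) + 3"
      using N1 Ni \<delta> by (subst log_mult) simp_all
    \<comment> \<open>The 16 in \<open>\<delta>\<close> enters once per factor, so the product is
      the square of \<open>16 * K\<close>; this 16 contributes 8 to the constant 11.\<close>
    also have "2 * norm_one A / \<delta> * (2 * norm_infty A / \<delta>) = (2 ^ 4 * K)\<^sup>2"
      using N1 Ni s by (simp add: K(2) \<delta>_def power_mult_distrib power_divide power2_eq_square[of s])
    also have "log 2 \<dots> = 2 * log 2 (2 ^ 4 * K)"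
      using K(1) by (subst log_nat_power) simp_all
    also have "log 2 (2 ^ 4 * K) = log 2 (2 ^ 4) + log 2 K"
      using K(1) by (subst log_mult) simp_all
    also have "log 2 (2 ^ 4) = (4 :: real)" by (subst log_nat_power) simp_all
    finally have "real_of_int (c + d + 1) \<le> 2 * log 2 K + 11" by simp
    from window_log_bound[OF s P K(1) w1 this] show ?thesis by (simp add: s_def P_def B_def)
  qed
qed

end
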